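(* Let $L$ be a finite distributive lattice with rank function $r$, let $\mu:L\to\mathbb{R}^+$ be log-supermodular, and let $0\le s\le t$. For $x\in L$ let $m(x)$ be the number of maximal chains in $[\hat 0,x]$, and for $k:L\to\mathbb{R}^+$ let $$E(k;q)=\sum_{x\in L} k(x)\,\mu(x)\,m(x)^t\,\frac{q^{r(x)}}{(r(x)!)^s}\in\mathbb{R}^+[q].$$ If $g,h:L\to\mathbb{R}^+$ are comonotone, then $E(g;q)\cdot E(h;q)\ll E(1;q)\cdot E(gh;q)$. If $g,h$ are countermonotone, the reverse inequality $E(1;q)\cdot E(gh;q)\ll E(g;q)\cdot E(h;q)$ holds.
   Context: $\mathbb{R}^+=\{r\in\mathbb{R}:r\ge 0\}$. The rank function $r$ assigns to $x$ the length of any maximal chain in $[\hat 0,x]$. A function $\mu:L\to\mathbb{R}^+$ is log-supermodular if $\mu(x)\mu(y)\le\mu(x\wedge y)\mu(x\vee y)$ for all $x,y$. A function is increasing if $x\le y\Rightarrow g(x)\le g(y)$ and decreasing if $x\le y\Rightarrow g(x)\ge g(y)$; two functions are comonotone if both increasing or both decreasing, countermonotone if one is increasing and the other decreasing. For real polynomials, $p(q)\ll s(q)$ means $s(q)-p(q)$ has all coefficients nonnegative. $1$ is the constant function and $gh$ the pointwise product. *)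

theory Defs
  imports Complex_Main "HOL-Computational_Algebra.Polynomial"
begin

definition max_chains :: "'a::order_bot \<Rightarrow> 'a set set" where
  "max_chains x = {C. pred_on.maxchain {bot..x} (<) C}"

definition num_max_chains :: "'a::order_bot \<Rightarrow> nat" where
  "num_max_chains x = card (max_chains x)"

(* The length of a chain is its number of elements minus one. The description is proper
   because all maximal chains in an interval of a finite distributive lattice have the same length. *)
definition lattice_rank :: "'a::order_bot \<Rightarrow> nat" where
  "lattice_rank x = (THE n. \<forall>C\<in>max_chains x. card C = n + 1)"

definition log_supermodular :: "('a::lattice \<Rightarrow> real) \<Rightarrow> bool" where
  "log_supermodular \<mu> \<longleftrightarrow> (\<forall>x y. \<mu> x * \<mu> y \<le> \<mu> (inf x y) * \<mu> (sup x y))"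

definition comonotone :: "('a::order \<Rightarrow> real) \<Rightarrow> ('a \<Rightarrow> real) \<Rightarrow> bool" where
  "comonotone g h \<longleftrightarrow> mono g \<and> mono h \<or> antimono g \<and> antimono h"

definition countermonotone :: "('a::order \<Rightarrow> real) \<Rightarrow> ('a \<Rightarrow> real) \<Rightarrow> bool" where
  "countermonotone g h \<longleftrightarrow> mono g \<and> antimono h \<or> antimono g \<and> mono h"

definition coeffwise_le :: "real poly \<Rightarrow> real poly \<Rightarrow> bool" (infix "\<lless>" 50) where
  "p \<lless> s \<longleftrightarrow> (\<forall>i. 0 \<le> coeff (s - p) i)"

(* The exponents are real; both bases are at least 1, so powr is the usual power. *)
definition E_poly ::
  "('a::{finite,order_bot} \<Rightarrow> real) \<Rightarrow> real \<Rightarrow> real \<Rightarrow> ('a \<Rightarrow> real) \<Rightarrow> real poly" where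
  "E_poly \<mu> s t k =
     (\<Sum>x\<in>UNIV. monom (k x * \<mu> x * real (num_max_chains x) powr t / fact (lattice_rank x) powr s)
                     (lattice_rank x))"

end

theory Submission
  imports Defs
begin

text \<open>The weight \<open>w(x) = \<mu>(x) m(x)^t / (r(x)!)^s\<close> is log-supermodular, because it is
  \<open>\<mu> \<cdot> (m / r!)^s \<cdot> m^(t - s)\<close> and \<open>m / r!\<close> is log-supermodular (Fishburn). For the latter, the
  number of multichains \<open>x1 \<le> ... \<le> xn \<le> x\<close> is log-supermodular in \<open>x\<close> by induction on \<open>n\<close> with the
  four functions theorem, and divided by \<open>n^(r(x))\<close> it tends to \<open>m(x) / r(x)!\<close>, while \<open>r\<close> is modular.

  A coefficient of \<open>E(1) E(gh) - E(g) E(h)\<close> is half the sum of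
  \<open>w(x) w(y) (g(x) - g(y)) (h(x) - h(y))\<close> over the pairs with \<open>r(x) + r(y)\<close> fixed. The pairs
  with given meet and join are the complementary pairs of an interval, and the FKG inequality
  on these gives the sign of each part of the sum (Bjoerner).\<close>

section \<open>The four functions theorem\<close>

text \<open>The case of a one-element ground set, with 1 for presence of the element and 0 for
  absence. Both mixed products p and q are at most M = \<open>c1 * d0\<close>, and p * q is at most
  M * (\<open>c0 * d1\<close>), so expanding (M - p) * (M - q) \<ge> 0 bounds p + q.\<close>

lemma four_functions_step:
  fixes a0 a1 b0 b1 c0 c1 d0 d1 :: real
  assumes nn: "0 \<le> a0" "0 \<le> a1" "0 \<le> b0" "0 \<le> b1" "0 \<le> c0" "0 \<le> c1" "0 \<le> d0" "0 \<le> d1"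
    and 00: "a0 * b0 \<le> c0 * d0" and 01: "a0 * b1 \<le> c1 * d0"
    and 10: "a1 * b0 \<le> c1 * d0" and 11: "a1 * b1 \<le> c1 * d1"
  shows "(a0 + a1) * (b0 + b1) \<le> (c0 + c1) * (d0 + d1)"
proof -
  have key: "a0 * b1 + a1 * b0 \<le> c1 * d0 + c0 * d1"
  proof (cases "c1 * d0 = 0")
    case True
    then show ?thesis using 01 10 nn by (smt (verit) mult_nonneg_nonneg)
  next
    case False
    then have M: "c1 * d0 > 0" using nn by (smt (verit) mult_nonneg_nonneg)
    have "(a0 * b1) * (a1 * b0) = (a0 * b0) * (a1 * b1)" by simp
    also have "\<dots> \<le> (c0 * d0) * (c1 * d1)"
      by (rule mult_mono[OF 00 11]) (use nn in simp_all)
    finally have le: "(a0 * b1) * (a1 * b0) \<le> (c1 * d0) * (c0 * d1)"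
      by (simp add: mult_ac)
    have "0 \<le> (c1 * d0 - a0 * b1) * (c1 * d0 - a1 * b0)"
      using 01 10 by simp
    then have "(c1 * d0) * (a0 * b1 + a1 * b0) \<le> (c1 * d0) * (c1 * d0 + c0 * d1)"
      using le by (simp add: algebra_simps)
    then show ?thesis using M mult_le_cancel_left_pos by blast
  qed
  then show ?thesis using 00 11 by (simp add: algebra_simps)
qed

lemma sum_Pow_insert:
  fixes f :: "'b set \<Rightarrow> real"
  assumes "finite S" "e \<notin> S"
  shows "(\<Sum>A\<in>Pow (insert e S). f A) = (\<Sum>A\<in>Pow S. f A + f (insert e A))"
proof -
  have "inj_on (insert e) (Pow S)"
    using assms(2) by (auto simp: inj_on_def)
  moreover have "Pow S \<inter> insert e ` Pow S = {}" using assms(2) by auto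
  ultimately show ?thesis
    using assms(1) by (simp add: Pow_insert sum.union_disjoint sum.reindex sum.distrib)
qed

text \<open>Induction on the ground set: summing out \<open>e\<close> replaces each function by
  \<open>?ext\<close> of it, and \<open>four_functions_step\<close> shows that the hypothesis
  survives this.\<close>

lemma four_functions_Pow:
  fixes \<alpha> \<beta> \<gamma> \<delta> :: "'b set \<Rightarrow> real"
  assumes "finite S"
    and "\<And>A. 0 \<le> \<alpha> A" "\<And>A. 0 \<le> \<beta> A" "\<And>A. 0 \<le> \<gamma> A" "\<And>A. 0 \<le> \<delta> A"
    and "\<And>A B. A \<subseteq> S \<Longrightarrow> B \<subseteq> S \<Longrightarrow> \<alpha> A * \<beta> B \<le> \<gamma> (A \<union> B) * \<delta> (A \<inter> B)"
  shows "sum \<alpha> (Pow S) * sum \<beta> (Pow S) \<le> sum \<gamma> (Pow S) * sum \<delta> (Pow S)"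
  using assms
proof (induction S arbitrary: \<alpha> \<beta> \<gamma> \<delta> rule: finite_induct)
  case empty
  then show ?case using empty(5)[of "{}" "{}"] by simp
next
  case (insert e S)
  let ?ext = "\<lambda>f :: 'b set \<Rightarrow> real. \<lambda>A. f A + f (insert e A)"
  have "sum (?ext \<alpha>) (Pow S) * sum (?ext \<beta>) (Pow S) \<le> sum (?ext \<gamma>) (Pow S) * sum (?ext \<delta>) (Pow S)"
  proof (rule insert.IH)
    fix A B assume AB: "A \<subseteq> S" "B \<subseteq> S"
    then have ne: "e \<notin> A" "e \<notin> B" using insert.hyps by auto
    then have eqs: "A \<inter> insert e B = A \<inter> B" "insert e A \<inter> B = A \<inter> B" by auto
    show "?ext \<alpha> A * ?ext \<beta> B \<le> ?ext \<gamma> (A \<union> B) * ?ext \<delta> (A \<inter> B)"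
    proof (rule four_functions_step)
      show "\<alpha> A * \<beta> B \<le> \<gamma> (A \<union> B) * \<delta> (A \<inter> B)"
        using AB by (intro insert.prems(5)) auto
      show "\<alpha> A * \<beta> (insert e B) \<le> \<gamma> (insert e (A \<union> B)) * \<delta> (A \<inter> B)"
        using AB insert.prems(5)[of A "insert e B"] by (auto simp: eqs)
      show "\<alpha> (insert e A) * \<beta> B \<le> \<gamma> (insert e (A \<union> B)) * \<delta> (A \<inter> B)"
        using AB insert.prems(5)[of "insert e A" B] by (auto simp: eqs)
      have "insert e A \<subseteq> insert e S" "insert e B \<subseteq> insert e S" using AB by auto
      from insert.prems(5)[OF this]
      show "\<alpha> (insert e A) * \<beta> (insert e B) \<le> \<gamma> (insert e (A \<union> B)) * \<delta> (insert e (A \<inter> B))"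
        by simp
    qed (use insert.prems in auto)
  qed (use insert.prems in auto)
  then show ?case using insert.hyps by (simp add: sum_Pow_insert)
qed

section \<open>Birkhoff's representation by join-prime elements\<close>

definition join_primes_below :: "'a::{lattice,order_bot} \<Rightarrow> 'a set" where
  "join_primes_below x = {j. j \<le> x \<and> j \<noteq> bot \<and> (\<forall>a b. j \<le> sup a b \<longrightarrow> j \<le> a \<or> j \<le> b)}"

lemma join_primes_below_inf:
  "join_primes_below (inf x y) = join_primes_below x \<inter> join_primes_below y"
  by (auto simp: join_primes_below_def)

lemma join_primes_below_sup:
  "join_primes_below (sup x y) = join_primes_below x \<union> join_primes_below y"
  by (auto simp: join_primes_below_def intro: le_supI1 le_supI2)

lemma join_primes_below_bot: "join_primes_below bot = {}"
  by (auto simp: join_primes_below_def dest: bot.extremum_uniqueI)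

text \<open>A minimal j among the elements below \<open>y\<close> but not below \<open>x\<close> is
  join-prime: everything strictly below j lies below \<open>x\<close>, so if j is below sup a b but
  below neither a nor b, distributivity makes j a join of two elements below
  \<open>x\<close>.\<close>

lemma join_prime_separates:
  fixes x y :: "'a::{finite,distrib_lattice,order_bot}"
  assumes "\<not> y \<le> x"
  obtains j where "j \<in> join_primes_below y" "\<not> j \<le> x"
proof -
  define S where "S = {z. z \<le> y \<and> \<not> z \<le> x}"
  have "finite S" "S \<noteq> {}" using assms by (auto simp: S_def)
  then obtain j where j: "j \<in> S" and min: "\<And>z. z \<in> S \<Longrightarrow> z \<le> j \<Longrightarrow> j = z"
    by (metis finite_has_minimal)
  have below: "z \<le> x" if "z \<le> j" "z \<noteq> j" for z
    using that j min[of z] order.trans[of z j y] by (auto simp: S_def)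
  have "j \<le> a \<or> j \<le> b" if le: "j \<le> sup a b" for a b
  proof (rule ccontr)
    assume c: "\<not> (j \<le> a \<or> j \<le> b)"
    have "inf j a \<le> x" "inf j b \<le> x"
      using c by (auto intro!: below dest: inf.orderI[OF sym])
    then have "sup (inf j a) (inf j b) \<le> x" by simp
    then have "inf j (sup a b) \<le> x" by (simp add: inf_sup_distrib1)
    then have "j \<le> x" using le by (simp add: inf.absorb1)
    then show False using j by (simp add: S_def)
  qed
  moreover have "j \<noteq> bot" using j by (auto simp: S_def)
  ultimately show thesis
    using j that[of j] by (auto simp: S_def join_primes_below_def)
qed

lemma join_primes_below_subset_iff:
  fixes x y :: "'a::{finite,distrib_lattice,order_bot}"
  shows "join_primes_below x \<subseteq> join_primes_below y \<longleftrightarrow> x \<le> y"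
proof
  assume sub: "join_primes_below x \<subseteq> join_primes_below y"
  show "x \<le> y"
  proof (rule ccontr)
    assume "\<not> x \<le> y"
    then obtain j where "j \<in> join_primes_below x" "\<not> j \<le> y" by (rule join_prime_separates)
    then show False using sub by (auto simp: join_primes_below_def)
  qed
qed (auto simp: join_primes_below_def intro: order.trans[of _ x y])

lemma inj_join_primes_below:
  "inj (join_primes_below :: 'a::{finite,distrib_lattice,order_bot} \<Rightarrow> 'a set)"
proof (rule injI)
  fix x y :: 'a
  assume "join_primes_below x = join_primes_below y"
  then have "x \<le> y" "y \<le> x" by (simp_all flip: join_primes_below_subset_iff)
  then show "x = y" by simp
qed

text \<open>Birkhoff's embedding turns joins and meets into unions and intersections, which carries
  the power set version over to the lattice.\<close>

theorem four_functions:
  fixes \<alpha> \<beta> \<gamma> \<delta> :: "'a::{finite,distrib_lattice,order_bot} \<Rightarrow> real"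
  assumes nn: "\<And>x. 0 \<le> \<alpha> x" "\<And>x. 0 \<le> \<beta> x" "\<And>x. 0 \<le> \<gamma> x" "\<And>x. 0 \<le> \<delta> x"
    and le: "\<And>x y. \<alpha> x * \<beta> y \<le> \<gamma> (sup x y) * \<delta> (inf x y)"
  shows "sum \<alpha> UNIV * sum \<beta> UNIV \<le> sum \<gamma> UNIV * sum \<delta> UNIV"
proof -
  let ?J = "join_primes_below :: 'a \<Rightarrow> 'a set"
  \<comment> \<open>Extension by zero keeps the sums and makes the inequality trivial as soon as
    \<open>A\<close> or \<open>B\<close> lies outside the range.\<close>
  define ext where "ext f A = (if A \<in> range ?J then f (inv ?J A) else 0)"
    for f :: "'a \<Rightarrow> real" and A
  have ext_J: "ext f (?J x) = f x" for f x
    by (simp add: ext_def inv_f_f[OF inj_join_primes_below])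
  have sum_ext: "sum (ext f) (Pow UNIV) = sum f UNIV" for f
  proof -
    have "sum (ext f) (Pow UNIV) = sum (ext f) (range ?J)"
      by (rule sum.mono_neutral_right) (auto simp: ext_def)
    also have "\<dots> = sum f UNIV"
      by (simp add: sum.reindex inj_join_primes_below ext_J)
    finally show ?thesis .
  qed
  have ext_nn: "0 \<le> ext f A" if "\<And>x. 0 \<le> f x" for f A
    using that by (simp add: ext_def)
  have "sum (ext \<alpha>) (Pow UNIV) * sum (ext \<beta>) (Pow UNIV)
      \<le> sum (ext \<gamma>) (Pow UNIV) * sum (ext \<delta>) (Pow UNIV)"
  proof (rule four_functions_Pow)
    fix A B :: "'a set"
    show "ext \<alpha> A * ext \<beta> B \<le> ext \<gamma> (A \<union> B) * ext \<delta> (A \<inter> B)"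
    proof (cases "A \<in> range ?J \<and> B \<in> range ?J")
      case True
      then obtain x y where "A = ?J x" "B = ?J y" by auto
      then show ?thesis
        using le[of x y]
        by (simp add: ext_J flip: join_primes_below_sup join_primes_below_inf)
    next
      case False
      then have "ext \<alpha> A * ext \<beta> B = 0" by (auto simp: ext_def)
      moreover have "0 \<le> ext \<gamma> (A \<union> B) * ext \<delta> (A \<inter> B)" by (simp add: ext_nn nn)
      ultimately show ?thesis by linarith
    qed
  qed (auto intro: ext_nn nn)
  then show ?thesis by (simp only: sum_ext)
qed

section \<open>Rank and maximal chains\<close>

text \<open>The working form of the rank, for which modularity is plain counting of sets. It is
  identified with \<open>lattice_rank\<close> through the length of maximal chains.\<close>

definition prime_rank :: "'a::{finite,distrib_lattice,order_bot} \<Rightarrow> nat" where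
  "prime_rank x = card (join_primes_below x)"

lemma prime_rank_modular:
  "prime_rank (inf x y) + prime_rank (sup x y) = prime_rank x + prime_rank y"
  unfolding prime_rank_def join_primes_below_inf join_primes_below_sup
  by (metis add.commute card_Un_Int finite)

lemma prime_rank_mono: "x \<le> y \<Longrightarrow> prime_rank x \<le> prime_rank y"
  unfolding prime_rank_def by (simp add: card_mono join_primes_below_subset_iff)

lemma prime_rank_strict_mono:
  assumes "x < y"
  shows "prime_rank x < prime_rank y"
proof -
  have "join_primes_below x \<subset> join_primes_below y"
    using assms by (simp add: psubset_eq join_primes_below_subset_iff less_le
        inj_eq[OF inj_join_primes_below])
  then show ?thesis by (simp add: prime_rank_def psubset_card_mono)
qed

lemma prime_rank_bot [simp]: "prime_rank bot = 0"
  by (simp add: prime_rank_def join_primes_below_bot)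

section \<open>Covers and the recursion for maximal chains\<close>

definition lower_covers :: "'a::{finite,distrib_lattice,order_bot} \<Rightarrow> 'a set" where
  "lower_covers x = {y. y < x \<and> prime_rank x = Suc (prime_rank y)}"

text \<open>Nothing fits between consecutive ranks. Conversely, if \<open>x\<close> covers
  \<open>y\<close>, then any two join-primes i, i' below \<open>x\<close> but not below
  \<open>y\<close> satisfy i \<le> sup y i' = x, whence i \<le> i' by primality; by symmetry there
  is only one.\<close>

lemma lower_covers_iff: "y \<in> lower_covers x \<longleftrightarrow> y < x \<and> (\<nexists>z. y < z \<and> z < x)"
proof
  assume y: "y \<in> lower_covers x"
  show "y < x \<and> (\<nexists>z. y < z \<and> z < x)"
    using y prime_rank_strict_mono[of y] prime_rank_strict_mono[of _ x]
    by (fastforce simp: lower_covers_def)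
next
  assume y: "y < x \<and> (\<nexists>z. y < z \<and> z < x)"
  then have "\<not> x \<le> y" by auto
  then obtain j where j: "j \<in> join_primes_below x" "\<not> j \<le> y" by (rule join_prime_separates)
  have "join_primes_below x = insert j (join_primes_below y)"
  proof -
    have sup_eq: "sup y i = x" if "i \<in> join_primes_below x" "\<not> i \<le> y" for i
    proof -
      have "y \<le> sup y i" "y \<noteq> sup y i" using that(2) sup.cobounded2[of i y] by (simp, metis)
      moreover have "sup y i \<le> x" using that y by (auto simp: join_primes_below_def)
      ultimately show ?thesis using y by (metis less_le)
    qed
    have le: "i \<le> i'" if "i \<in> join_primes_below x" "\<not> i \<le> y"
      "i' \<in> join_primes_below x" "\<not> i' \<le> y" for i i'
    proof -
      have "i \<le> sup y i'" using sup_eq[OF that(3,4)] that(1) by (simp add: join_primes_below_def)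
      then show ?thesis using that(1,2) by (auto simp: join_primes_below_def)
    qed
    have "i = j" if "i \<in> join_primes_below x" "\<not> i \<le> y" for i
      using le[OF that j] le[OF j that] by simp
    then show ?thesis using j(1) y
      by (auto simp: join_primes_below_def dest: less_imp_le)
  qed
  moreover have "j \<notin> join_primes_below y" using j by (auto simp: join_primes_below_def)
  ultimately show "y \<in> lower_covers x"
    using y by (simp add: lower_covers_def prime_rank_def)
qed

text \<open>A chain that is not maximal can be enlarged by a single element, so maximality can be
  tested one element at a time.\<close>

lemma max_chains_iff:
  "C \<in> max_chains x \<longleftrightarrow> C \<subseteq> {bot..x} \<and> (\<forall>u\<in>C. \<forall>v\<in>C. u \<le> v \<or> v \<le> u) \<and>
     (\<forall>z\<in>{bot..x}. (\<forall>u\<in>C. u \<le> z \<or> z \<le> u) \<longrightarrow> z \<in> C)"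
proof -
  have chain: "pred_on.chain {bot..x} (<) D \<longleftrightarrow> D \<subseteq> {bot..x} \<and> (\<forall>u\<in>D. \<forall>v\<in>D. u \<le> v \<or> v \<le> u)" for D
    by (auto simp: pred_on.chain_def le_less)
  show ?thesis (is "_ \<longleftrightarrow> ?R")
  proof
    assume "C \<in> max_chains x"
    then have c: "pred_on.chain {bot..x} (<) C" and
      m: "\<And>D. pred_on.chain {bot..x} (<) D \<Longrightarrow> \<not> C \<subset> D"
      by (auto simp: max_chains_def pred_on.maxchain_def)
    have "z \<in> C" if "z \<in> {bot..x}" "\<forall>u\<in>C. u \<le> z \<or> z \<le> u" for z
    proof (rule ccontr)
      assume "z \<notin> C"
      moreover have "pred_on.chain {bot..x} (<) (insert z C)"
        using c that unfolding chain by auto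
      ultimately show False using m[of "insert z C"] by auto
    qed
    then show ?R using c unfolding chain by auto
  next
    assume R: ?R
    then have "pred_on.chain {bot..x} (<) C" by (simp add: chain)
    moreover have "\<not> C \<subset> D" if "pred_on.chain {bot..x} (<) D" for D
      using that R unfolding chain by (meson psubsetE subset_eq)
    ultimately show "C \<in> max_chains x"
      by (simp add: max_chains_def pred_on.maxchain_def)
  qed
qed

lemma max_chains_bot: "max_chains bot = {{bot}}"
  by (auto simp: max_chains_iff set_eq_iff subset_iff dest: bot.extremum_uniqueI)

lemma max_chains_top_mem: "C \<in> max_chains x \<Longrightarrow> x \<in> C"
  unfolding max_chains_iff by (metis atLeastAtMost_iff bot.extremum order_refl subsetD)

text \<open>Deleting \<open>x\<close> from a maximal chain leaves a maximal chain below the greatest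
  remaining element, and no element fits between that one and \<open>x\<close>.\<close>

lemma max_chains_rec:
  fixes x :: "'a::{finite,distrib_lattice,order_bot}"
  assumes "x \<noteq> bot"
  shows "max_chains x = (\<Union>y\<in>lower_covers x. insert x ` max_chains y)"
proof (intro equalityI subsetI)
  fix C assume C: "C \<in> max_chains x"
  have xC: "x \<in> C" by (rule max_chains_top_mem[OF C])
  have lex: "\<And>u. u \<in> C \<Longrightarrow> u \<le> x"
    and lin: "\<And>u v. u \<in> C \<Longrightarrow> v \<in> C \<Longrightarrow> u \<le> v \<or> v \<le> u"
    and max: "\<And>z. z \<le> x \<Longrightarrow> (\<And>u. u \<in> C \<Longrightarrow> u \<le> z \<or> z \<le> u) \<Longrightarrow> z \<in> C"
    using C by (auto simp: max_chains_iff)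
  \<comment> \<open>\<open>bot\<close> is comparable with everything, so it lies in every maximal
    chain; this ensures that something remains below \<open>x\<close>.\<close>
  have "bot \<in> C - {x}" using assms by (auto intro: max)
  then obtain y where y: "y \<in> C - {x}" and ymax: "\<And>u. u \<in> C - {x} \<Longrightarrow> y \<le> u \<Longrightarrow> y = u"
    by (metis empty_iff finite finite_has_maximal)
  have ley: "u \<le> y" if "u \<in> C" "u \<noteq> x" for u
    using lin[of u y] ymax[of u] y that by auto
  have "y < x" using y lex[of y] by (simp add: less_le)
  have "\<not> (y < z \<and> z < x)" for z
  proof
    assume z: "y < z \<and> z < x"
    have "z \<in> C"
    proof (rule max)
      show "z \<le> x" using z by (simp add: less_imp_le)
      show "u \<le> z \<or> z \<le> u" if "u \<in> C" for u
        using ley[OF that] z order.trans[of u y z] by (cases "u = x") (simp_all add: less_imp_le)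
    qed
    then show False using ley[of z] z by (metis leD less_irrefl)
  qed
  then have "y \<in> lower_covers x" using \<open>y < x\<close> by (auto simp: lower_covers_iff)
  moreover have "C - {x} \<in> max_chains y"
    unfolding max_chains_iff
  proof (intro conjI ballI impI)
    show "C - {x} \<subseteq> {bot..y}" using ley by (simp add: subset_iff)
    show "u \<le> v \<or> v \<le> u" if "u \<in> C - {x}" "v \<in> C - {x}" for u v
      using lin that by simp
    fix z assume z: "z \<in> {bot..y}" "\<forall>u\<in>C - {x}. u \<le> z \<or> z \<le> u"
    then have "z < x" using \<open>y < x\<close> by auto
    then show "z \<in> C - {x}" using z by (auto intro!: max)
  qed
  moreover have "C = insert x (C - {x})" using xC by auto
  ultimately show "C \<in> (\<Union>y\<in>lower_covers x. insert x ` max_chains y)" by blast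
next
  fix C assume "C \<in> (\<Union>y\<in>lower_covers x. insert x ` max_chains y)"
  then obtain y D where y: "y \<in> lower_covers x" and D: "D \<in> max_chains y" and C: "C = insert x D"
    by auto
  have yx: "y < x" and cov: "\<And>z. y < z \<Longrightarrow> \<not> z < x" using y by (auto simp: lower_covers_iff)
  have yD: "y \<in> D" by (rule max_chains_top_mem[OF D])
  have ley: "\<And>u. u \<in> D \<Longrightarrow> u \<le> y" and lin: "\<And>u v. u \<in> D \<Longrightarrow> v \<in> D \<Longrightarrow> u \<le> v \<or> v \<le> u"
    and max: "\<And>z. z \<le> y \<Longrightarrow> (\<And>u. u \<in> D \<Longrightarrow> u \<le> z \<or> z \<le> u) \<Longrightarrow> z \<in> D"
    using D by (auto simp: max_chains_iff)
  show "C \<in> max_chains x"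
    unfolding max_chains_iff
  proof (intro conjI ballI impI)
    show "C \<subseteq> {bot..x}" using ley yx C by (fastforce intro: less_imp_le)
    show "u \<le> v \<or> v \<le> u" if "u \<in> C" "v \<in> C" for u v
      using that lin less_imp_le[OF order.strict_trans1[OF ley yx]] unfolding C by auto
    fix z assume z: "z \<in> {bot..x}" "\<forall>u\<in>C. u \<le> z \<or> z \<le> u"
    show "z \<in> C"
    proof (cases "z = x")
      case False
      then have "z < x" using z by auto
      then have "\<not> y < z" using cov by blast
      moreover have "z \<le> y \<or> y \<le> z" using z yD by (auto simp: C)
      ultimately have "z \<le> y" by (auto simp: le_less)
      then show ?thesis using z by (auto simp: C intro: max)
    qed (simp add: C)
  qed
qed

text \<open>Each step down to a lower cover loses one element and one unit of rank; the chain
  \<open>{bot}\<close> accounts for the extra 1.\<close>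

lemma card_max_chain:
  fixes x :: "'a::{finite,distrib_lattice,order_bot}"
  assumes "C \<in> max_chains x"
  shows "card C = prime_rank x + 1"
  using assms
proof (induction "prime_rank x" arbitrary: x C)
  case 0
  then have "x = bot" using prime_rank_strict_mono[of bot x] by (metis bot.not_eq_extremum less_irrefl prime_rank_bot)
  then show ?case using 0 by (simp add: max_chains_bot)
next
  case (Suc n)
  then have "x \<noteq> bot" by auto
  then obtain y D where y: "y \<in> lower_covers x" and D: "D \<in> max_chains y" and C: "C = insert x D"
    using Suc.prems by (auto simp: max_chains_rec)
  have "x \<notin> D" using D y by (auto simp: max_chains_iff lower_covers_def)
  moreover have "card D = prime_rank y + 1"
    using y Suc.hyps(2) by (intro Suc.hyps(1)[OF _ D]) (simp add: lower_covers_def)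
  ultimately show ?case using y by (simp add: C lower_covers_def)
qed

text \<open>The union in \<open>max_chains_rec\<close> is disjoint, since the lower cover is
  recovered as the greatest element of the chain without \<open>x\<close>.\<close>

lemma num_max_chains_rec:
  fixes x :: "'a::{finite,distrib_lattice,order_bot}"
  assumes "x \<noteq> bot"
  shows "num_max_chains x = (\<Sum>y\<in>lower_covers x. num_max_chains y)"
proof -
  have notin: "x \<notin> D" if "y \<in> lower_covers x" "D \<in> max_chains y" for y D
    using that by (auto simp: max_chains_iff lower_covers_def)
  have "num_max_chains x = (\<Sum>y\<in>lower_covers x. card (insert x ` max_chains y))"
    unfolding num_max_chains_def max_chains_rec[OF assms]
  proof (rule card_UN_disjoint)
    show "\<forall>y\<in>lower_covers x. \<forall>z\<in>lower_covers x. y \<noteq> z \<longrightarrow>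
        insert x ` max_chains y \<inter> insert x ` max_chains z = {}"
    proof (intro ballI impI)
      fix y z assume yz: "y \<in> lower_covers x" "z \<in> lower_covers x" "y \<noteq> z"
      have False if "D \<in> max_chains y" "E \<in> max_chains z" "insert x D = insert x E" for D E
      proof -
        have "D = E"
          using insert_ident[OF notin[OF yz(1) that(1)] notin[OF yz(2) that(2)]] that(3) by simp
        then have "y \<in> D" "z \<in> D" using that max_chains_top_mem by auto
        then have "y \<in> {bot..z}" "z \<in> {bot..y}"
          using that \<open>D = E\<close> unfolding max_chains_iff by blast+
        then show False using yz by simp
      qed
      then show "insert x ` max_chains y \<inter> insert x ` max_chains z = {}" by blast
    qed
  qed auto
  also have "\<dots> = (\<Sum>y\<in>lower_covers x. num_max_chains y)"
    unfolding num_max_chains_def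
  proof (intro sum.cong refl card_image inj_onI)
    fix y D E
    assume "y \<in> lower_covers x" "D \<in> max_chains y" "E \<in> max_chains y" "insert x D = insert x E"
    then show "D = E" using insert_ident[OF notin notin] by simp
  qed
  finally show ?thesis .
qed

lemma num_max_chains_pos:
  fixes x :: "'a::{finite,distrib_lattice,order_bot}"
  shows "0 < num_max_chains x"
proof (induction "prime_rank x" arbitrary: x rule: less_induct)
  case less
  show ?case
  proof (cases "x = bot")
    case True
    then show ?thesis by (simp add: num_max_chains_def max_chains_bot)
  next
    case False
    then have "{y. y < x} \<noteq> {}" by (auto simp: bot.not_eq_extremum)
    then obtain y where y: "y < x" and "\<And>z. z < x \<Longrightarrow> y \<le> z \<Longrightarrow> y = z"
      by (metis (mono_tags, lifting) finite finite_has_maximal mem_Collect_eq)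
    then have y': "y \<in> lower_covers x" by (metis less_imp_le less_irrefl lower_covers_iff)
    moreover have "0 < num_max_chains y" using y by (intro less prime_rank_strict_mono)
    ultimately show ?thesis
      using False by (metis num_max_chains_rec finite member_le_sum order.strict_trans2 zero_le)
  qed
qed

text \<open>The existence of a maximal chain pins down the description, whose condition would
  otherwise be vacuous.\<close>

lemma lattice_rank_eq: "lattice_rank x = prime_rank x"
proof -
  obtain C where "C \<in> max_chains x"
    using num_max_chains_pos[of x] by (auto simp: num_max_chains_def card_gt_0_iff)
  then show ?thesis
    unfolding lattice_rank_def by (intro the_equality) (auto simp: card_max_chain)
qed

text \<open>Log-convexity of the factorial: with a = c + k and b = c + l, raising l by one
  multiplies the left side by c + l + 1 and the right side by the larger c + k + l + 1.\<close>

lemma fact_mult_fact_le: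
  fixes a b c d :: nat
  assumes "a + b = c + d" "c \<le> a" "c \<le> b"
  shows "(fact a * fact b :: real) \<le> fact c * fact d"
proof -
  have "(fact (c + k) * fact (c + l) :: real) \<le> fact c * fact (c + k + l)" for k l
  proof (induction l)
    case (Suc l)
    have "(fact (c + k) * fact (c + Suc l) :: real) = real (c + l + 1) * (fact (c + k) * fact (c + l))"
      by (simp only: add_Suc_right fact_Suc Suc_eq_plus1[symmetric] mult_ac)
    also have "\<dots> \<le> real (c + k + l + 1) * (fact c * fact (c + k + l))"
      by (intro mult_mono Suc.IH) auto
    finally show ?case by (simp add: mult_ac)
  qed simp
  from this[of "a - c" "b - c"] show ?thesis
    using assms by (simp add: algebra_simps)
qed

section \<open>Multichains and log-supermodularity of the weights\<close>

lemma log_supermodularD: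
  "log_supermodular f \<Longrightarrow> f x * f y \<le> f (inf x y) * f (sup x y)"
  by (simp add: log_supermodular_def)

lemma log_supermodular_mult:
  assumes "log_supermodular f" "log_supermodular g" "\<And>x. 0 \<le> f x" "\<And>x. 0 \<le> g x"
  shows "log_supermodular (\<lambda>x. f x * g x)"
  unfolding log_supermodular_def
proof (intro allI)
  fix x y
  have "(f x * f y) * (g x * g y) \<le> (f (inf x y) * f (sup x y)) * (g (inf x y) * g (sup x y))"
    using assms by (intro mult_mono log_supermodularD) auto
  then show "f x * g x * (f y * g y) \<le> f (inf x y) * g (inf x y) * (f (sup x y) * g (sup x y))"
    by (simp add: mult_ac)
qed

lemma log_supermodular_powr:
  assumes "log_supermodular f" "\<And>x. 0 \<le> f x" "0 \<le> p"
  shows "log_supermodular (\<lambda>x. f x powr p)"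
  using assms by (auto simp: log_supermodular_def simp flip: powr_mult intro!: powr_mono2)

text \<open>The four functions theorem applied to \<open>f\<close> cut off to the principal ideals
  of \<open>x\<close>, \<open>y\<close>, their join and their meet.\<close>

lemma log_supermodular_sum_below:
  fixes f :: "'a::{finite,distrib_lattice,order_bot} \<Rightarrow> real"
  assumes lsm: "log_supermodular f" and nn: "\<And>x. 0 \<le> f x"
  shows "log_supermodular (\<lambda>x. \<Sum>y | y \<le> x. f y)"
  unfolding log_supermodular_def
proof (intro allI)
  fix x y :: 'a
  let ?r = "\<lambda>x z. if z \<le> x then f z else 0"
  have *: "(\<Sum>y | y \<le> x. f y) = sum (?r x) UNIV" for x
    by (rule sum.mono_neutral_cong_left) auto
  have "sum (?r x) UNIV * sum (?r y) UNIV \<le> sum (?r (sup x y)) UNIV * sum (?r (inf x y)) UNIV"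
  proof (rule four_functions)
    fix u v
    have "sup u v \<le> sup x y" "inf u v \<le> inf x y" if "u \<le> x" "v \<le> y"
      by (rule sup_mono[OF that], rule inf_mono[OF that])
    then show "?r x u * ?r y v \<le> ?r (sup x y) (sup u v) * ?r (inf x y) (inf u v)"
      using log_supermodularD[OF lsm, of u v] nn by (simp add: mult.commute)
  qed (simp_all add: nn)
  then show "(\<Sum>y | y \<le> x. f y) * (\<Sum>z | z \<le> y. f z)
      \<le> (\<Sum>z | z \<le> inf x y. f z) * (\<Sum>z | z \<le> sup x y. f z)"
    unfolding * by (simp only: mult.commute)
qed

section \<open>Multichains, strict chains and their growth\<close>

primrec num_multichains :: "nat \<Rightarrow> 'a::{finite,order} \<Rightarrow> nat" where
  "num_multichains 0 x = 1"
| "num_multichains (Suc n) x = (\<Sum>y | y \<le> x. num_multichains n y)"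

primrec num_strict_chains :: "nat \<Rightarrow> 'a::{finite,order} \<Rightarrow> nat" where
  "num_strict_chains 0 x = 1"
| "num_strict_chains (Suc n) x = (\<Sum>y | y < x. num_strict_chains n y)"

lemma log_supermodular_num_multichains:
  "log_supermodular (\<lambda>x :: 'a::{finite,distrib_lattice,order_bot}. real (num_multichains n x))"
proof (induction n)
  case 0
  show ?case by (simp add: log_supermodular_def)
next
  case (Suc n)
  from log_supermodular_sum_below[OF this] show ?case by simp
qed

text \<open>With \<open>x\<close> appended, a multichain of n entries has n steps; choosing the k
  strict ones leaves a strict chain of k elements below \<open>x\<close>. This is the zeta
  polynomial of the interval in the binomial basis, and the induction is Pascal's rule.\<close>

lemma num_multichains_binomial:
  "num_multichains n x = (\<Sum>k\<le>n. (n choose k) * num_strict_chains k x)"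
proof (induction n arbitrary: x)
  case (Suc n)
  have "{y. y \<le> x} = insert x {y. y < x}" by auto
  then have "num_multichains (Suc n) x = num_multichains n x + (\<Sum>y | y < x. num_multichains n y)"
    by simp
  also have "(\<Sum>y | y < x. num_multichains n y)
      = (\<Sum>k\<le>n. (n choose k) * num_strict_chains (Suc k) x)"
    by (simp add: Suc.IH sum_distrib_left sum.swap[of _ "{..n}"])
  also have "num_multichains n x = (\<Sum>k\<le>Suc n. (n choose k) * num_strict_chains k x)"
    by (simp add: Suc.IH)
  also have "\<dots> = 1 + (\<Sum>k\<le>n. (n choose Suc k) * num_strict_chains (Suc k) x)"
    by (subst sum.atMost_Suc_shift) simp
  also have "\<dots> + (\<Sum>k\<le>n. (n choose k) * num_strict_chains (Suc k) x)
      = 1 + (\<Sum>k\<le>n. (Suc n choose Suc k) * num_strict_chains (Suc k) x)"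
    by (simp add: sum.distrib algebra_simps)
  also have "\<dots> = (\<Sum>k\<le>Suc n. (Suc n choose k) * num_strict_chains k x)"
    by (subst sum.atMost_Suc_shift) simp
  finally show ?case .
qed simp

lemma num_strict_chains_eq_0:
  "prime_rank x < k \<Longrightarrow> num_strict_chains k x = 0"
proof (induction k arbitrary: x)
  case (Suc k)
  then show ?case using prime_rank_strict_mono[of _ x] by fastforce
qed simp

text \<open>A strict chain this long loses exactly one unit of rank at each step, so only lower
  covers contribute and the recursion is that of maximal chains.\<close>

lemma num_strict_chains_prime_rank:
  "num_strict_chains (prime_rank x) x = num_max_chains x"
proof (induction "prime_rank x" arbitrary: x)
  case 0
  then have "x = bot"
    using prime_rank_strict_mono[of bot x] by (metis bot.not_eq_extremum less_irrefl prime_rank_bot)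
  then show ?case by (simp add: num_max_chains_def max_chains_bot)
next
  case (Suc k)
  have "num_strict_chains (prime_rank x) x = (\<Sum>y | y < x. num_strict_chains k y)"
    by (simp flip: Suc.hyps(2))
  also have "\<dots> = (\<Sum>y\<in>lower_covers x. num_max_chains y)"
  proof (rule sum.mono_neutral_cong_right)
    show "\<forall>y\<in>{y. y < x} - lower_covers x. num_strict_chains k y = 0"
    proof
      fix y assume "y \<in> {y. y < x} - lower_covers x"
      then have "prime_rank y < k"
        using prime_rank_strict_mono[of y x] Suc.hyps(2) by (auto simp: lower_covers_def)
      then show "num_strict_chains k y = 0" by (rule num_strict_chains_eq_0)
    qed
    show "num_strict_chains k y = num_max_chains y" if "y \<in> lower_covers x" for y
      using that Suc.hyps by (auto simp: lower_covers_def)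
  qed (auto simp: lower_covers_def)
  also have "\<dots> = num_max_chains x"
    using Suc.hyps(2) by (subst num_max_chains_rec) auto
  finally show ?case .
qed

text \<open>A range of summation independent of n, so that limits can be taken termwise. Both ranges
  extend to their maximum, where the added terms vanish through the binomial or for lack of strict
  chains.\<close>

lemma num_multichains_binomial_rank:
  "num_multichains n x = (\<Sum>k\<le>prime_rank x. (n choose k) * num_strict_chains k x)"
proof -
  have "(\<Sum>k\<le>N. (n choose k) * num_strict_chains k x)
      = (\<Sum>k\<le>max n (prime_rank x). (n choose k) * num_strict_chains k x)"
    if "N = n \<or> N = prime_rank x" for N
    using that by (intro sum.mono_neutral_left) (auto simp: num_strict_chains_eq_0)
  then show ?thesis unfolding num_multichains_binomial by metis
qed

lemma choose_div_power_tendsto: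
  "(\<lambda>n. real (n choose k) / real n ^ k) \<longlonglongrightarrow> 1 / fact k"
proof (induction k)
  case (Suc k)
  have step: "real (n choose Suc k) / real n ^ Suc k
      = real (n choose k) / real n ^ k * ((1 - real k * (1 / real n)) / real (Suc k))" if "n > 0" for n
  proof -
    \<comment> \<open>Over the reals this covers n < k as well, where both binomials are
      zero.\<close>
    have "real (Suc k) * real (n choose Suc k) = (real n - real k) * real (n choose k)"
    proof (cases "k \<le> n")
      case True
      then show ?thesis
        using binomial_absorb_comp[of n k] binomial_absorption[of k n]
        by (metis of_nat_diff of_nat_mult)
    qed (simp add: binomial_eq_0)
    then have "real (n choose Suc k) = (real n - real k) * real (n choose k) / real (Suc k)"
      by (simp add: field_simps del: of_nat_Suc)
    then show ?thesis using that by (simp add: field_simps del: of_nat_Suc)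
  qed
  have "(\<lambda>n. real (n choose k) / real n ^ k * ((1 - real k * (1 / real n)) / real (Suc k)))
      \<longlonglongrightarrow> 1 / fact k * ((1 - real k * 0) / real (Suc k))"
    by (intro tendsto_intros Suc.IH lim_1_over_n) simp
  then have "(\<lambda>n. real (n choose Suc k) / real n ^ Suc k) \<longlonglongrightarrow> 1 / fact k * ((1 - real k * 0) / real (Suc k))"
    by (rule Lim_transform_eventually) (use step in \<open>auto intro!: eventually_sequentiallyI[of 1]\<close>)
  then show ?case by (simp add: mult.commute)
qed simp

lemma num_multichains_tendsto:
  "(\<lambda>n. real (num_multichains n x) / real n ^ prime_rank x)
     \<longlonglongrightarrow> real (num_max_chains x) / fact (prime_rank x)"
proof -
  let ?r = "prime_rank x"
  have split: "real (num_multichains n x) / real n ^ ?r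
      = (\<Sum>k\<le>?r. real (n choose k) / real n ^ k * (1 / real n) ^ (?r - k) * num_strict_chains k x)" for n
  proof -
    have "real n ^ ?r = real n ^ k * real n ^ (?r - k)" if "k \<le> ?r" for k
      using that by (simp flip: power_add)
    then show ?thesis
      by (simp add: num_multichains_binomial_rank sum_divide_distrib power_one_over)
  qed
  \<comment> \<open>Only the term k = \<open>?r\<close> survives in the limit, as
    \<open>0 ^ (?r - k)\<close> is zero for smaller k and \<open>0 ^ 0\<close> is 1.\<close>
  have "(\<lambda>n. \<Sum>k\<le>?r. real (n choose k) / real n ^ k * (1 / real n) ^ (?r - k) * num_strict_chains k x)
      \<longlonglongrightarrow> (\<Sum>k\<le>?r. 1 / fact k * 0 ^ (?r - k) * num_strict_chains k x)"
    by (intro tendsto_intros choose_div_power_tendsto lim_1_over_n)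
  also have "(\<Sum>k\<le>?r. 1 / fact k * 0 ^ (?r - k) * num_strict_chains k x)
      = (\<Sum>k\<in>{?r}. 1 / fact k * 0 ^ (?r - k) * real (num_strict_chains k x))"
    by (rule sum.mono_neutral_right) auto
  finally show ?thesis by (simp add: split num_strict_chains_prime_rank)
qed

text \<open>Fishburn's inequality for linear extensions, obtained as the limit of the inequality for
  multichains.\<close>

theorem log_supermodular_max_chains_div_fact:
  "log_supermodular (\<lambda>x :: 'a::{finite,distrib_lattice,order_bot}.
     real (num_max_chains x) / fact (prime_rank x))"
  unfolding log_supermodular_def
proof (intro allI)
  fix x y :: 'a
  let ?f = "\<lambda>n x. real (num_multichains n x) / real n ^ prime_rank x"
  \<comment> \<open>By modularity of the rank both sides have the same power of n as
    denominator.\<close>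
  have "?f n x * ?f n y \<le> ?f n (inf x y) * ?f n (sup x y)" for n
    using log_supermodularD[OF log_supermodular_num_multichains[of n], of x y]
    by (simp add: prime_rank_modular divide_right_mono flip: power_add)
  then show "real (num_max_chains x) / fact (prime_rank x) * (real (num_max_chains y) / fact (prime_rank y))
      \<le> real (num_max_chains (inf x y)) / fact (prime_rank (inf x y))
        * (real (num_max_chains (sup x y)) / fact (prime_rank (sup x y)))"
    by (intro LIMSEQ_le[OF tendsto_mult[OF num_multichains_tendsto num_multichains_tendsto]
          tendsto_mult[OF num_multichains_tendsto num_multichains_tendsto]]) blast
qed

lemma log_supermodular_fact_prime_rank:
  "log_supermodular (\<lambda>x :: 'a::{finite,distrib_lattice,order_bot}. fact (prime_rank x) :: real)"
  unfolding log_supermodular_def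
  by (auto intro!: fact_mult_fact_le prime_rank_mono simp: prime_rank_modular)

lemma log_supermodular_max_chains:
  "log_supermodular (\<lambda>x :: 'a::{finite,distrib_lattice,order_bot}. real (num_max_chains x))"
  using log_supermodular_mult[OF log_supermodular_max_chains_div_fact log_supermodular_fact_prime_rank]
  by simp

lemma log_supermodular_weight:
  fixes \<mu> :: "'a::{finite,distrib_lattice,order_bot} \<Rightarrow> real"
  assumes "log_supermodular \<mu>" "\<And>x. 0 \<le> \<mu> x" "0 \<le> s" "s \<le> t"
  shows "log_supermodular (\<lambda>x. \<mu> x * real (num_max_chains x) powr t / fact (prime_rank x) powr s)"
proof -
  have eq: "real (num_max_chains x) powr t / fact (prime_rank x) powr s
      = (real (num_max_chains x) / fact (prime_rank x)) powr s * real (num_max_chains x) powr (t - s)"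
    for x :: 'a
    using num_max_chains_pos[of x] by (simp add: powr_divide powr_diff)
  have "log_supermodular (\<lambda>x. \<mu> x * ((real (num_max_chains x) / fact (prime_rank x)) powr s
      * real (num_max_chains x) powr (t - s)))"
    using assms
    by (intro log_supermodular_mult log_supermodular_powr log_supermodular_max_chains
        log_supermodular_max_chains_div_fact) auto
  then show ?thesis by (simp add: eq flip: times_divide_eq_right)
qed

section \<open>The FKG inequality and its refinement by rank\<close>

text \<open>The four functions are \<nu> g, \<nu> h, \<nu> g h and \<nu>. Monotonicity on the
  support suffices, because log-supermodularity puts the join of two support points into the
  support; the later application has \<nu> vanishing outside a sublattice.\<close>

lemma fkg_nonneg:
  fixes \<nu> g h :: "'a::{finite,distrib_lattice,order_bot} \<Rightarrow> real"
  assumes nn: "\<And>x. 0 \<le> \<nu> x" "\<And>x. 0 \<le> g x" "\<And>x. 0 \<le> h x" and lsm: "log_supermodular \<nu>"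
    and g: "mono_on {x. \<nu> x \<noteq> 0} g" and h: "mono_on {x. \<nu> x \<noteq> 0} h"
  shows "(\<Sum>x\<in>UNIV. \<nu> x * g x) * (\<Sum>x\<in>UNIV. \<nu> x * h x)
       \<le> (\<Sum>x\<in>UNIV. \<nu> x * (g x * h x)) * (\<Sum>x\<in>UNIV. \<nu> x)"
proof (rule four_functions)
  fix x y
  have le: "\<nu> x * \<nu> y \<le> \<nu> (inf x y) * \<nu> (sup x y)" by (rule log_supermodularD[OF lsm])
  show "\<nu> x * g x * (\<nu> y * h y) \<le> \<nu> (sup x y) * (g (sup x y) * h (sup x y)) * \<nu> (inf x y)"
  proof (cases "\<nu> x * \<nu> y = 0")
    case False
    then have "0 < \<nu> x * \<nu> y" using nn(1)[of x] nn(1)[of y] by (simp add: less_le)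
    then have "\<nu> (sup x y) \<noteq> 0" using le by auto
    then have "g x \<le> g (sup x y)" "h y \<le> h (sup x y)"
      using False by (auto intro!: mono_onD[OF g] mono_onD[OF h])
    then have "(\<nu> x * \<nu> y) * (g x * h y)
        \<le> (\<nu> (inf x y) * \<nu> (sup x y)) * (g (sup x y) * h (sup x y))"
      using nn by (intro mult_mono[OF le] mult_mono) auto
    then show ?thesis by (simp add: mult_ac)
  qed (use nn in auto)
qed (use nn in auto)

text \<open>The signed version, for differences such as \<open>g x - g (c x)\<close>. Adding a
  constant to both functions changes the two sides equally, and a large constant makes the functions
  nonnegative.\<close>

theorem fkg:
  fixes \<nu> g h :: "'a::{finite,distrib_lattice,order_bot} \<Rightarrow> real"
  assumes nn: "\<And>x. 0 \<le> \<nu> x" and lsm: "log_supermodular \<nu>"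
    and g: "mono_on {x. \<nu> x \<noteq> 0} g" and h: "mono_on {x. \<nu> x \<noteq> 0} h"
  shows "(\<Sum>x\<in>UNIV. \<nu> x * g x) * (\<Sum>x\<in>UNIV. \<nu> x * h x)
       \<le> (\<Sum>x\<in>UNIV. \<nu> x * (g x * h x)) * (\<Sum>x\<in>UNIV. \<nu> x)"
proof -
  define c where "c = (\<Sum>x\<in>UNIV. \<bar>g x\<bar> + \<bar>h x\<bar>)"
  have c: "\<bar>g x\<bar> + \<bar>h x\<bar> \<le> c" for x
    unfolding c_def by (rule member_le_sum) auto
  have "0 \<le> g x + c" "0 \<le> h x + c" for x
    using c[of x] by linarith+
  moreover have "mono_on {x. \<nu> x \<noteq> 0} (\<lambda>x. g x + c)" "mono_on {x. \<nu> x \<noteq> 0} (\<lambda>x. h x + c)"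
    using g h by (auto simp: monotone_on_def)
  ultimately have "(\<Sum>x\<in>UNIV. \<nu> x * (g x + c)) * (\<Sum>x\<in>UNIV. \<nu> x * (h x + c))
       \<le> (\<Sum>x\<in>UNIV. \<nu> x * ((g x + c) * (h x + c))) * (\<Sum>x\<in>UNIV. \<nu> x)"
    by (intro fkg_nonneg nn lsm)
  moreover have shift: "(\<Sum>x\<in>UNIV. \<nu> x * (f x + c)) = (\<Sum>x\<in>UNIV. \<nu> x * f x) + c * (\<Sum>x\<in>UNIV. \<nu> x)" for f
    by (simp add: distrib_left sum.distrib sum_distrib_left mult.commute)
  moreover have shift2: "(\<Sum>x\<in>UNIV. \<nu> x * ((g x + c) * (h x + c)))
      = (\<Sum>x\<in>UNIV. \<nu> x * (g x * h x)) + c * (\<Sum>x\<in>UNIV. \<nu> x * g x)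
        + c * (\<Sum>x\<in>UNIV. \<nu> x * h x) + c * c * (\<Sum>x\<in>UNIV. \<nu> x)"
    by (simp add: algebra_simps sum.distrib sum_distrib_left)
  ultimately show ?thesis unfolding shift shift2 by (simp add: distrib_left distrib_right mult_ac)
qed

text \<open>The elements with a relative complement in the interval from \<open>a\<close> to \<open>b\<close> form a sublattice
  on which complementation \<open>c\<close> is an order-reversing involution. Hence
  \<open>x \<mapsto> \<mu> x * \<mu> (c x)\<close> is again log-supermodular, and the increasing function
  \<open>x \<mapsto> g x - g (c x)\<close> has mean zero with respect to it.\<close>

lemma complement_pairs_sum_nonneg:
  fixes \<mu> g h :: "'a::{finite,distrib_lattice,order_bot} \<Rightarrow> real"
  assumes nn: "\<And>x. 0 \<le> \<mu> x" and lsm: "log_supermodular \<mu>" and g: "mono g" and h: "mono h"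
  shows "0 \<le> (\<Sum>(x, y) | inf x y = a \<and> sup x y = b. \<mu> x * \<mu> y * ((g x - g y) * (h x - h y)))"
proof -
  define compl where "compl x y \<longleftrightarrow> inf x y = a \<and> sup x y = b" for x y
  define B where "B = {x. \<exists>y. compl x y}"
  define c where "c x = (SOME y. compl x y)" for x
  have c: "compl x (c x)" if "x \<in> B" for x
    using that unfolding B_def c_def by (auto intro: someI)
  have sym: "compl x y \<Longrightarrow> compl y x" for x y
    by (simp add: compl_def inf_commute sup_commute)
  \<comment> \<open>Complementation reverses the order; the case x = x' gives uniqueness of relative
    complements, hence \<open>c_eq\<close>.\<close>
  have mono_c: "y' \<le> y" if "compl x y" "compl x' y'" "x \<le> x'" for x y x' y'
  proof -
    have "y' = inf y' (sup x y)"
      using that unfolding compl_def by (metis inf.absorb1 sup.cobounded2)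
    also have "\<dots> = sup (inf y' x) (inf y' y)" by (rule inf_sup_distrib1)
    also have "\<dots> \<le> y"
    proof -
      have "inf y' x \<le> inf x' y'" using that(3) by (simp add: le_infI2)
      also have "\<dots> \<le> y" using that by (metis compl_def inf.cobounded2)
      finally show ?thesis by simp
    qed
    finally show ?thesis .
  qed
  have c_eq: "c x = y" if "compl x y" for x y
    using mono_c that c[of x] by (metis B_def antisym mem_Collect_eq order_refl)
  have cB: "c x \<in> B" "c (c x) = x" if "x \<in> B" for x
    using sym[OF c[OF that]] c_eq by (auto simp: B_def)
  \<comment> \<open>De Morgan's law for relative complements; together with \<open>sym\<close> it
    covers joins as well as meets.\<close>
  have closed: "compl (inf x y) (sup x' y')" if "compl x x'" "compl y y'" for x x' y y'
  proof -
    have eqs: "inf x x' = a" "sup x x' = b" "inf y y' = a" "sup y y' = b"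
      using that by (auto simp: compl_def)
    then have le: "a \<le> x" "a \<le> y" "x' \<le> b" "y' \<le> b"
      by (metis inf.cobounded1 sup.cobounded2)+
    have "inf (inf x y) x' = inf y (inf x x')" "inf (inf x y) y' = inf x (inf y y')"
      by (simp_all add: inf_commute inf_left_commute)
    then have "inf (inf x y) x' = a" "inf (inf x y) y' = a"
      using le by (simp_all add: eqs inf.absorb2)
    moreover have "sup x (sup x' y') = sup y' (sup x x')" "sup y (sup x' y') = sup x' (sup y y')"
      by (simp_all add: sup_commute sup_left_commute)
    then have "sup x (sup x' y') = b" "sup y (sup x' y') = b"
      using le by (simp_all add: eqs sup.absorb2)
    ultimately show ?thesis
      by (simp add: compl_def inf_sup_distrib1[of "inf x y"] sup_inf_distrib2)
  qed
  \<comment> \<open>The value zero outside \<open>B\<close> lets the FKG inequality for the whole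
    lattice act on the sublattice \<open>B\<close>.\<close>
  define \<nu> where "\<nu> x = (if x \<in> B then \<mu> x * \<mu> (c x) else 0)" for x
  have \<nu>_nn: "0 \<le> \<nu> x" for x using nn by (simp add: \<nu>_def)
  have \<nu>_lsm: "log_supermodular \<nu>"
    unfolding log_supermodular_def
  proof (intro allI)
    fix x y
    show "\<nu> x * \<nu> y \<le> \<nu> (inf x y) * \<nu> (sup x y)"
    proof (cases "x \<in> B \<and> y \<in> B")
      case True
      then have "compl x (c x)" "compl y (c y)" by (simp_all add: c)
      then have "compl (inf x y) (sup (c x) (c y))" "compl (sup x y) (inf (c x) (c y))"
        using closed sym by blast+
      then have "inf x y \<in> B" "sup x y \<in> B"
        "c (inf x y) = sup (c x) (c y)" "c (sup x y) = inf (c x) (c y)"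
        using c_eq unfolding B_def by blast+
      moreover have "(\<mu> x * \<mu> y) * (\<mu> (c x) * \<mu> (c y))
          \<le> (\<mu> (inf x y) * \<mu> (sup x y)) * (\<mu> (inf (c x) (c y)) * \<mu> (sup (c x) (c y)))"
        using lsm nn by (intro mult_mono log_supermodularD) auto
      ultimately show ?thesis using True by (simp add: \<nu>_def mult_ac)
    next
      case False
      then have "\<nu> x * \<nu> y = 0" by (auto simp: \<nu>_def)
      then show ?thesis by (simp only: mult_nonneg_nonneg \<nu>_nn)
    qed
  qed
  let ?d = "\<lambda>f x. f x - f (c x)"
  have mono_d: "mono_on {x. \<nu> x \<noteq> 0} (?d f)" if "mono f" for f :: "'a \<Rightarrow> real"
  proof (rule mono_onI)
    fix x y assume xy: "x \<in> {x. \<nu> x \<noteq> 0}" "y \<in> {x. \<nu> x \<noteq> 0}" "x \<le> y"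
    then have "x \<in> B" "y \<in> B" by (auto simp: \<nu>_def split: if_splits)
    then have "compl x (c x)" "compl y (c y)" by (simp_all add: c)
    then have "c y \<le> c x" using mono_c xy(3) by blast
    then show "?d f x \<le> ?d f y" by (intro diff_mono) (simp_all add: monoD[OF that] xy(3))
  qed
  have sum_B: "(\<Sum>x\<in>UNIV. \<nu> x * f x) = (\<Sum>x\<in>B. \<mu> x * \<mu> (c x) * f x)" for f
    by (rule sum.mono_neutral_cong_right) (auto simp: \<nu>_def)
  \<comment> \<open>The involution \<open>c\<close> keeps the weight and negates the difference, so
    the sum equals its own negative.\<close>
  have zero: "(\<Sum>x\<in>UNIV. \<nu> x * ?d f x) = 0" for f
  proof -
    have "(\<Sum>x\<in>B. \<mu> x * \<mu> (c x) * ?d f x) = (\<Sum>x\<in>B. - (\<mu> x * \<mu> (c x) * ?d f x))"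
      by (rule sum.reindex_bij_witness[of _ c c]) (auto simp: cB algebra_simps)
    then show ?thesis by (simp add: sum_B sum_negf)
  qed
  have "0 \<le> (\<Sum>x\<in>UNIV. \<nu> x * (?d g x * ?d h x)) * (\<Sum>x\<in>UNIV. \<nu> x)"
    using fkg[OF \<nu>_nn \<nu>_lsm mono_d[OF g] mono_d[OF h]] by (simp only: zero mult_zero_left)
  \<comment> \<open>The total mass is divided out of the FKG inequality; if it is zero, \<nu>
    vanishes everywhere.\<close>
  moreover have "(\<Sum>x\<in>UNIV. \<nu> x * (?d g x * ?d h x)) = 0" if "(\<Sum>x\<in>UNIV. \<nu> x) = 0"
    using that by (simp add: sum_nonneg_eq_0_iff \<nu>_nn)
  moreover have "0 \<le> (\<Sum>x\<in>UNIV. \<nu> x)" by (simp add: sum_nonneg \<nu>_nn)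
  ultimately have "0 \<le> (\<Sum>x\<in>UNIV. \<nu> x * (?d g x * ?d h x))"
    by (cases "(\<Sum>x\<in>UNIV. \<nu> x) = 0") (simp_all add: zero_le_mult_iff)
  also have "\<dots> = (\<Sum>x\<in>B. \<mu> x * \<mu> (c x) * (?d g x * ?d h x))" by (rule sum_B)
  also have "\<dots> = (\<Sum>(x, y) | compl x y. \<mu> x * \<mu> y * ((g x - g y) * (h x - h y)))"
    by (rule sum.reindex_bij_witness[of _ fst "\<lambda>x. (x, c x)"]) (auto simp: c c_eq B_def)
  finally show ?thesis by (simp add: compl_def)
qed

text \<open>By modularity the rank condition depends only on the meet and the join, so each fibre of
  (x, y) \<mapsto> (inf x y, sup x y) is either left out or summed in full by
  \<open>complement_pairs_sum_nonneg\<close>.\<close>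

lemma rank_pairs_sum_nonneg:
  fixes \<mu> g h :: "'a::{finite,distrib_lattice,order_bot} \<Rightarrow> real"
  assumes "\<And>x. 0 \<le> \<mu> x" "log_supermodular \<mu>" "mono g" "mono h"
  shows "0 \<le> (\<Sum>(x, y) | prime_rank x + prime_rank y = n. \<mu> x * \<mu> y * ((g x - g y) * (h x - h y)))"
    (is "0 \<le> sum ?f ?S")
proof -
  let ?io = "\<lambda>(x, y). (inf x y, sup x y) :: 'a \<times> 'a"
  have "0 \<le> sum ?f {p \<in> ?S. ?io p = q}" for q
  proof (cases q)
    case (Pair a b)
    show ?thesis
    proof (cases "prime_rank a + prime_rank b = n")
      case True
      then have "{p \<in> ?S. ?io p = q} = {(x, y). inf x y = a \<and> sup x y = b}"
        using prime_rank_modular[where ?'a = 'a] by (auto simp: Pair)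
      then show ?thesis using complement_pairs_sum_nonneg[OF assms, of a b] by simp
    next
      case False
      then have "{p \<in> ?S. ?io p = q} = {}"
        using prime_rank_modular[where ?'a = 'a] by (auto simp: Pair)
      then show ?thesis by (simp only: sum.empty order_refl)
    qed
  qed
  then have "0 \<le> (\<Sum>q\<in>UNIV. sum ?f {p \<in> ?S. ?io p = q})" by (rule sum_nonneg)
  also have "\<dots> = sum ?f ?S" by (rule sum.group) auto
  finally show ?thesis .
qed

section \<open>Coefficients of the polynomial products\<close>

lemma coeff_mult_sum_monom:
  fixes u v :: "'a::finite \<Rightarrow> real"
  shows "coeff ((\<Sum>x\<in>UNIV. monom (u x) (r x)) * (\<Sum>x\<in>UNIV. monom (v x) (r x))) n
    = (\<Sum>(x, y) | r x + r y = n. u x * v y)"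
proof -
  have "coeff ((\<Sum>x\<in>UNIV. monom (u x) (r x)) * (\<Sum>x\<in>UNIV. monom (v x) (r x))) n
      = (\<Sum>(x, y)\<in>UNIV. if r x + r y = n then u x * v y else 0)"
    by (simp add: sum_product mult_monom coeff_sum) (simp add: sum.cartesian_product)
  also have "\<dots> = (\<Sum>(x, y) | r x + r y = n. u x * v y)"
    by (rule sum.mono_neutral_cong_right) (auto split: if_splits)
  finally show ?thesis .
qed

text \<open>Chebyshev's symmetrization: the index set is invariant under swapping x and y, and
  adding the swapped sum to the original one completes the product of differences.\<close>

lemma coeff_covariance:
  fixes w g h :: "'a::finite \<Rightarrow> real" and r :: "'a \<Rightarrow> nat"
  defines "P \<equiv> \<lambda>k. \<Sum>x\<in>UNIV. monom (k x * w x) (r x)"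
  shows "2 * coeff (P (\<lambda>x. 1) * P (\<lambda>x. g x * h x) - P g * P h) n
    = (\<Sum>(x, y) | r x + r y = n. w x * w y * ((g x - g y) * (h x - h y)))"
proof -
  let ?S = "{(x, y). r x + r y = n}"
  define d where "d = coeff (P (\<lambda>x. 1) * P (\<lambda>x. g x * h x) - P g * P h) n"
  have d: "d = (\<Sum>(x, y)\<in>?S. w x * w y * (g y * h y - g x * h y))"
    by (simp add: d_def P_def coeff_mult_sum_monom case_prod_beta algebra_simps flip: sum_subtractf)
  also have "\<dots> = (\<Sum>(x, y)\<in>?S. w x * w y * (g x * h x - g y * h x))"
    by (rule sum.reindex_bij_witness[of _ prod.swap prod.swap]) (auto simp: add.commute mult.commute)
  finally have "2 * d = (\<Sum>(x, y)\<in>?S. w x * w y * (g y * h y - g x * h y))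
      + (\<Sum>(x, y)\<in>?S. w x * w y * (g x * h x - g y * h x))"
    using d by simp
  also have "\<dots> = (\<Sum>(x, y)\<in>?S. w x * w y * ((g x - g y) * (h x - h y)))"
    by (simp add: case_prod_beta algebra_simps flip: sum.distrib)
  finally show ?thesis by (simp add: d_def)
qed

theorem theorem5p3:
  fixes \<mu> g h :: "'a::{finite,distrib_lattice,order_bot} \<Rightarrow> real"
    and s t :: real
  assumes "\<And>x. 0 \<le> \<mu> x"
    and "log_supermodular \<mu>"
    and "0 \<le> s" and "s \<le> t"
    and "\<And>x. 0 \<le> g x"
    and "\<And>x. 0 \<le> h x"
  shows "(comonotone g h \<longrightarrow>
            E_poly \<mu> s t g * E_poly \<mu> s t h \<lless> E_poly \<mu> s t (\<lambda>x. 1) * E_poly \<mu> s t (\<lambda>x. g x * h x))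
       \<and> (countermonotone g h \<longrightarrow>
            E_poly \<mu> s t (\<lambda>x. 1) * E_poly \<mu> s t (\<lambda>x. g x * h x) \<lless> E_poly \<mu> s t g * E_poly \<mu> s t h)"
proof -
  define w where "w x = \<mu> x * real (num_max_chains x) powr t / fact (prime_rank x) powr s" for x
  have E: "E_poly \<mu> s t = (\<lambda>k. \<Sum>x\<in>UNIV. monom (k x * w x) (prime_rank x))"
    by (simp add: fun_eq_iff E_poly_def lattice_rank_eq w_def mult.assoc)
  have w: "0 \<le> w x" "log_supermodular w" for x
    using assms(1) log_supermodular_weight[OF assms(2,1,3,4)] by (auto simp: w_def[abs_def])
  let ?D = "\<lambda>n g h. \<Sum>(x, y) | prime_rank x + prime_rank y = n. w x * w y * ((g x - g y) * (h x - h y))"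
  have D: "0 \<le> ?D n g h" if "mono g" "mono h" for n and g h :: "'a \<Rightarrow> real"
    using rank_pairs_sum_nonneg[OF w(1) w(2) that] .
  have cov: "2 * coeff (E_poly \<mu> s t (\<lambda>x. 1) * E_poly \<mu> s t (\<lambda>x. g x * h x)
      - E_poly \<mu> s t g * E_poly \<mu> s t h) n = ?D n g h" for n
    unfolding E by (rule coeff_covariance)
  \<comment> \<open>\<open>?D\<close> is bilinear in the two functions: negating both preserves it
    and negating one flips its sign, which reduces decreasing functions to increasing ones.\<close>
  have neg: "mono (\<lambda>x. - f x)" if "antimono f" for f :: "'a \<Rightarrow> real"
    using that by (simp add: monotone_on_def)
  have "0 \<le> ?D n g h" if "comonotone g h" for n
    using that D[of g h n] D[of "\<lambda>x. - g x" "\<lambda>x. - h x" n] neg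
    by (auto simp: comonotone_def algebra_simps)
  moreover have "?D n g h \<le> 0" if "countermonotone g h" for n
  proof -
    have "?D n (\<lambda>x. - g x) h = - ?D n g h" "?D n g (\<lambda>x. - h x) = - ?D n g h"
      by (simp_all add: case_prod_beta algebra_simps flip: sum_negf)
    then show ?thesis
      using that D[of "\<lambda>x. - g x" h n] D[of g "\<lambda>x. - h x" n] neg
      by (auto simp: countermonotone_def)
  qed
  ultimately show ?thesis
    by (auto simp: coeffwise_le_def simp flip: cov)
qed

end
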